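(* Let $r$ and $s$ be non-negative integers with $r\ge 3s+6$. Then $F_v(2_r;r-s-1)\le r+2s+7$.
   Context: All graphs are finite, undirected, without loops or multiple edges. $\omega(G)$ is the clique number of $G$. $G\to^v(2_r)$ means that every partition of $V(G)$ into $r$ pairwise disjoint (possibly empty) classes has a class containing an edge, i.e. $\chi(G)\ge r+1$. $H_v(2_r;q)$ is the set of graphs $G$ with $G\to^v(2_r)$ and $\omega(G)<q$, and $F_v(2_r;q)=\min\{|V(G)|:G\in H_v(2_r;q)\}$ (it exists whenever $q\ge 3$). *)

theory Defs
  imports
    "Graph_Theory.Pair_Digraph"
    "HOL-Library.Disjoint_Sets"
    "HOL-Library.Extended_Nat"
begin

text \<open>
  A finite simple graph is a \<^locale>\<open>pair_graph\<close>: finite vertex set, symmetric loop-free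
  adjacency relation. An edge between u and v is the pair of opposite arcs (u, v), (v, u).
\<close>

definition clique_number :: "'a pair_pre_digraph \<Rightarrow> nat" where
  "clique_number G =
     Max {card K | K. K \<subseteq> pverts G \<and> (\<forall>u\<in>K. \<forall>v\<in>K. u \<noteq> v \<longrightarrow> (u, v) \<in> parcs G)}"

text \<open>
  \<open>vertex_arrow G r\<close> is the relation written \<open>G \<rightarrow>\<^sup>v (2\<^sub>r)\<close>;
  the classes are indexed by {..<r}, so they may be empty.
\<close>

definition vertex_arrow :: "'a pair_pre_digraph \<Rightarrow> nat \<Rightarrow> bool" where
  "vertex_arrow G r \<longleftrightarrow>
     (\<forall>C :: nat \<Rightarrow> 'a set. disjoint_family_on C {..<r} \<and> (\<Union>i<r. C i) = pverts G \<longrightarrow>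
        (\<exists>i<r. \<exists>u\<in>C i. \<exists>v\<in>C i. (u, v) \<in> parcs G))"

text \<open>
  Vertices are taken from \<^typ>\<open>nat\<close>, which loses nothing: every finite graph is isomorphic to
  one on natural numbers. The minimum is taken in \<^typ>\<open>enat\<close>: it is the least order of a graph
  in \<open>H_v r q\<close> if there is one, and \<open>\<infinity>\<close> otherwise, so a finite upper bound on
  \<open>F_v r q\<close> includes the existence of such a graph.
\<close>

definition H_v :: "nat \<Rightarrow> nat \<Rightarrow> nat pair_pre_digraph set" where
  "H_v r q = {G. pair_graph G \<and> vertex_arrow G r \<and> clique_number G < q}"

definition F_v :: "nat \<Rightarrow> nat \<Rightarrow> enat" where
  "F_v r q = (INF G\<in>H_v r q. enat (card (pverts G)))"

end

theory Submission
  imports Defs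
begin

text \<open>
  Under joins the order, the chromatic number and the clique number are additive. The circulant
  graph on \<open>\<int>/13\<close> complementary to the (3,5)-Ramsey graph with connection set \<open>{\<plusminus>1, \<plusminus>5}\<close>
  has independence number 2, hence chromatic number at least 7, and clique number 4. Joining it
  with s copies of the 5-cycle, each contributing \<open>\<chi> = 3\<close> and \<open>\<omega> = 2\<close>, and with a complete graph on
  \<open>r - 3 s - 6\<close> vertices gives order \<open>r + 2 s + 7\<close>, chromatic number at least \<open>r + 1\<close> and clique
  number at most \<open>r - s - 2\<close>.
\<close>

definition proper_colouring :: "'a set \<Rightarrow> ('a \<Rightarrow> 'a \<Rightarrow> bool) \<Rightarrow> ('a \<Rightarrow> nat) \<Rightarrow> bool" where
  "proper_colouring V E f \<longleftrightarrow> (\<forall>u\<in>V. \<forall>v\<in>V. E u v \<longrightarrow> f u \<noteq> f v)"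

definition is_clique :: "('a \<Rightarrow> 'a \<Rightarrow> bool) \<Rightarrow> 'a set \<Rightarrow> bool" where
  "is_clique E K \<longleftrightarrow> (\<forall>u\<in>K. \<forall>v\<in>K. u \<noteq> v \<longrightarrow> E u v)"

text \<open>\<open>k\<close> and \<open>w\<close> are bounds, not exact invariants. Counting the
  colours that \<open>f\<close> actually uses makes the lower bound additive under joins.\<close>

definition realizable :: "nat \<Rightarrow> nat \<Rightarrow> nat \<Rightarrow> bool" where
  "realizable n k w \<longleftrightarrow>
     (\<exists>E. symp E \<and> irreflp E \<and>
        (\<forall>f. proper_colouring {..<n} E f \<longrightarrow> k \<le> card (f ` {..<n})) \<and>
        (\<forall>K\<subseteq>{..<n}. is_clique E K \<longrightarrow> card K \<le> w))"

text \<open>All cross pairs are adjacent, so a proper colouring uses disjoint sets of colours on the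
  two sides, while a clique is the union of one clique from each side.\<close>

lemma realizable_join:
  assumes "realizable n k w" and "realizable n' k' w'"
  shows "realizable (n + n') (k + k') (w + w')"
proof -
  obtain E where E: "symp E" "irreflp E"
    "\<And>f. proper_colouring {..<n} E f \<Longrightarrow> k \<le> card (f ` {..<n})"
    "\<And>K. K \<subseteq> {..<n} \<Longrightarrow> is_clique E K \<Longrightarrow> card K \<le> w"
    using assms(1) unfolding realizable_def by blast
  obtain E' where E': "symp E'" "irreflp E'"
    "\<And>f. proper_colouring {..<n'} E' f \<Longrightarrow> k' \<le> card (f ` {..<n'})"
    "\<And>K. K \<subseteq> {..<n'} \<Longrightarrow> is_clique E' K \<Longrightarrow> card K \<le> w'"
    using assms(2) unfolding realizable_def by blast
  \<comment> \<open>The second graph is shifted by \<open>n\<close>; the last branch holds exactly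
    the cross pairs.\<close>
  define J where "J u v \<longleftrightarrow>
    (if u < n \<and> v < n then E u v else if u \<ge> n \<and> v \<ge> n then E' (u - n) (v - n) else True)"
    for u v
  have split: "{..<n + n'} = {..<n} \<union> (\<lambda>v. v + n) ` {..<n'}"
  proof -
    have "u \<in> (\<lambda>v. v + n) ` {..<n'}" if "u < n + n'" "\<not> u < n" for u
      using that by (intro image_eqI[of _ _ "u - n"]) auto
    then show ?thesis by auto
  qed
  have "symp J"
    using E(1) E'(1) by (auto simp: symp_def J_def)
  moreover have "irreflp J"
    using E(2) E'(2) by (auto simp: irreflp_def J_def)
  moreover have "k + k' \<le> card (f ` {..<n + n'})" if f: "proper_colouring {..<n + n'} J f" for f
  proof -
    let ?g = "\<lambda>v. f (v + n)"
    have neq: "f u \<noteq> f v" if "u < n + n'" "v < n + n'" "J u v" for u v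
      using f that by (auto simp: proper_colouring_def)
    have "k \<le> card (f ` {..<n})"
      using neq by (intro E(3)) (auto simp: proper_colouring_def J_def)
    moreover have "k' \<le> card (?g ` {..<n'})"
      using neq by (intro E'(3)) (auto simp: proper_colouring_def J_def)
    moreover have "f ` {..<n} \<inter> ?g ` {..<n'} = {}"
    proof -
      have "f u \<noteq> ?g v" if "u < n" "v < n'" for u v
        using that by (intro neq) (auto simp: J_def)
      then show ?thesis by auto
    qed
    moreover have "f ` {..<n + n'} = f ` {..<n} \<union> ?g ` {..<n'}"
      unfolding split by (simp add: image_Un image_image)
    ultimately show ?thesis
      by (simp add: card_Un_disjoint)
  qed
  moreover have "card K \<le> w + w'" if K: "K \<subseteq> {..<n + n'}" "is_clique J K" for K
  proof -
    let ?K1 = "K \<inter> {..<n}" and ?K2 = "{v. v + n \<in> K}"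
    have "card ?K1 \<le> w"
      using K by (intro E(4)) (auto simp: is_clique_def J_def)
    moreover have "card ?K2 \<le> w'"
    proof (intro E'(4))
      show "is_clique E' ?K2"
        unfolding is_clique_def
      proof (intro ballI impI)
        fix u v assume "u \<in> ?K2" "v \<in> ?K2" "u \<noteq> v"
        then have "J (u + n) (v + n)"
          using K(2) by (auto simp: is_clique_def)
        then show "E' u v" by (simp add: J_def)
      qed
    qed (use K in auto)
    moreover have "K \<subseteq> ?K1 \<union> (\<lambda>v. v + n) ` ?K2"
      using K(1) unfolding split by auto
    then have "card K \<le> card (?K1 \<union> (\<lambda>v. v + n) ` ?K2)"
    proof (rule card_mono[rotated])
      have "?K2 \<subseteq> {..<n'}" using K by auto
      then show "finite (?K1 \<union> (\<lambda>v. v + n) ` ?K2)"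
        using finite_subset by auto
    qed
    then have "card K \<le> card ?K1 + card ((\<lambda>v. v + n) ` ?K2)"
      using card_Un_le order_trans by blast
    moreover have "card ((\<lambda>v. v + n) ` ?K2) = card ?K2"
      by (intro card_image) auto
    ultimately show ?thesis by linarith
  qed
  ultimately show ?thesis unfolding realizable_def by blast
qed

lemma realizable_copies:
  assumes "realizable n k w"
  shows "realizable (m * n) (m * k) (m * w)"
proof (induction m)
  case 0
  show ?case
    by (auto simp: realizable_def symp_def irreflp_def intro!: exI[of _ "\<lambda>_ _. False"])
next
  case (Suc m)
  show ?case using realizable_join[OF assms Suc] by simp
qed

lemma realizable_vertex: "realizable 1 1 1"
proof -
  have "card K \<le> 1" if "K \<subseteq> {..<1}" for K :: "nat set"
    using card_mono[OF _ that] by simp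
  then show ?thesis
    unfolding realizable_def
    by (intro exI[of _ "\<lambda>_ _. False"]) (auto simp: symp_def irreflp_def lessThan_Suc)
qed

text \<open>An executable branching on whether the clique contains \<open>x\<close>, so that
  concrete clique bounds can be proved by evaluation.\<close>

fun max_clique :: "('a \<Rightarrow> 'a \<Rightarrow> bool) \<Rightarrow> 'a list \<Rightarrow> nat" where
  "max_clique E [] = 0"
| "max_clique E (x # xs) = max (max_clique E xs) (Suc (max_clique E (filter (E x) xs)))"

lemma card_clique_le:
  assumes "K \<subseteq> set xs" and "is_clique E K"
  shows "card K \<le> max_clique E xs"
  using assms
proof (induction E xs arbitrary: K rule: max_clique.induct)
  case (1 E)
  then show ?case by simp
next
  case (2 E x xs)
  show ?case
  proof (cases "x \<in> K")
    case True
    have "card (K - {x}) \<le> max_clique E (filter (E x) xs)"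
      using 2(3,4) True by (intro 2(2)) (auto simp: is_clique_def)
    moreover have "finite K"
      using 2(3) finite_subset by blast
    then have "card K = Suc (card (K - {x}))"
      using True by (rule card.remove)
    ultimately show ?thesis by simp
  next
    case False
    then have "card K \<le> max_clique E xs"
      using 2(3,4) by (intro 2(1)) auto
    then show ?thesis by simp
  qed
qed

text \<open>Colour classes are independent, that is, cliques of the complement, so each has at most
  \<open>a\<close> vertices.\<close>

lemma card_le_colours_times_independence:
  assumes "finite V" and "proper_colouring V E f"
    and "\<And>K. K \<subseteq> V \<Longrightarrow> is_clique (\<lambda>u v. \<not> E u v) K \<Longrightarrow> card K \<le> a"
  shows "card V \<le> card (f ` V) * a"
proof -
  have "card V = (\<Sum>c\<in>f ` V. card {v \<in> V. f v = c})"
    using sum.image_gen[OF assms(1), of "\<lambda>_. 1::nat" f] by simp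
  also have "\<dots> \<le> (\<Sum>c\<in>f ` V. a)"
    using assms(2) by (intro sum_mono assms(3)) (auto simp: proper_colouring_def is_clique_def, metis)
  finally show ?thesis by simp
qed

text \<open>
  The sum of the two truncated differences is \<open>\<bar>u - v\<bar>\<close>; for a set D closed under \<open>d \<mapsto> n - d\<close>,
  the relation restricted to \<open>{..<n}\<close> is the circulant graph with connection set D.
\<close>

definition distance_adj :: "nat list \<Rightarrow> nat \<Rightarrow> nat \<Rightarrow> bool" where
  "distance_adj D u v \<longleftrightarrow> (u - v) + (v - u) \<in> set D"

text \<open>Independence number at most 2 forces at least n/2 colours, rounded up; both clique
  bounds are left to computation.\<close>

lemma realizable_distance_graph:
  assumes "0 \<notin> set D" and "max_clique (distance_adj D) [0..<n] \<le> w"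
    and "max_clique (\<lambda>u v. \<not> distance_adj D u v) [0..<n] \<le> 2"
  shows "realizable n ((n + 1) div 2) w"
  unfolding realizable_def
proof (intro exI conjI allI impI)
  show "symp (distance_adj D)"
    by (auto simp: symp_def distance_adj_def add.commute)
  show "irreflp (distance_adj D)"
    using assms(1) by (simp add: irreflp_def distance_adj_def)
  have set: "set [0..<n] = {..<n}" by auto
  show "card K \<le> w" if "K \<subseteq> {..<n}" "is_clique (distance_adj D) K" for K
    using card_clique_le[of K "[0..<n]"] that assms(2) unfolding set by fastforce
  show "(n + 1) div 2 \<le> card (f ` {..<n})"
    if "proper_colouring {..<n} (distance_adj D) f" for f
  proof -
    have "card {..<n} \<le> card (f ` {..<n}) * 2"
    proof (rule card_le_colours_times_independence[OF _ that])
      show "card K \<le> 2" if "K \<subseteq> {..<n}" "is_clique (\<lambda>u v. \<not> distance_adj D u v) K" for K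
        using card_clique_le[of K "[0..<n]"] that assms(3) unfolding set by fastforce
    qed simp
    then show ?thesis by simp
  qed
qed

lemma realizable_5_cycle: "realizable 5 3 2"
proof -
  \<comment> \<open>Distance 4 = 5 - 1 is the edge that closes the path 0, ..., 4 to a
    cycle.\<close>
  have "max_clique (distance_adj [1, 4]) [0..<5] \<le> 2"
    "max_clique (\<lambda>u v. \<not> distance_adj [1, 4] u v) [0..<5] \<le> 2"
    by code_simp+
  then show ?thesis
    using realizable_distance_graph[of "[1, 4]" 5 2] by simp
qed

lemma realizable_Ramsey_graph: "realizable 13 7 4"
proof -
  \<comment> \<open>These are the nonzero residues mod 13 other than 1, 5, 8, 12, which are
    \<plusminus>1 and \<plusminus>5.\<close>
  let ?D = "[2, 3, 4, 6, 7, 9, 10, 11]"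
  have "max_clique (distance_adj ?D) [0..<13] \<le> 4"
    "max_clique (\<lambda>u v. \<not> distance_adj ?D u v) [0..<13] \<le> 2"
    by code_simp+
  then show ?thesis
    using realizable_distance_graph[of ?D 13 4] by simp
qed

lemma F_v_le_of_realizable:
  assumes "realizable n (Suc r) w" and "w < q"
  shows "F_v r q \<le> enat n"
proof -
  obtain E where E: "symp E" "irreflp E"
    "\<And>f. proper_colouring {..<n} E f \<Longrightarrow> Suc r \<le> card (f ` {..<n})"
    "\<And>K. K \<subseteq> {..<n} \<Longrightarrow> is_clique E K \<Longrightarrow> card K \<le> w"
    using assms(1) unfolding realizable_def by blast
  define G where "G = \<lparr>pverts = {..<n}, parcs = {(u, v). u < n \<and> v < n \<and> E u v}\<rparr>"
  have "finite (parcs G)"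
    by (rule finite_subset[of _ "{..<n} \<times> {..<n}"]) (auto simp: G_def)
  then have "pair_graph G"
    using E(1,2)
    by unfold_locales (auto simp: G_def irreflp_def symmetric_def arcs_ends_def arc_to_ends_def
        with_proj_def intro!: symI dest: sympD)
  moreover have "vertex_arrow G r"
    unfolding vertex_arrow_def
  proof (intro allI impI)
    fix C :: "nat \<Rightarrow> nat set"
    assume C: "disjoint_family_on C {..<r} \<and> (\<Union>i<r. C i) = pverts G"
    then have "\<forall>u<n. \<exists>i<r. u \<in> C i"
      by (auto simp: G_def)
    \<comment> \<open>Choosing a class for each vertex gives a colouring with at most
      \<open>r\<close> colours. It cannot be proper, and a monochromatic edge lies inside one
      class.\<close>
    then obtain f where f: "\<And>u. u < n \<Longrightarrow> f u < r \<and> u \<in> C (f u)"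
      by metis
    have "card (f ` {..<n}) \<le> card {..<r}"
      using f by (intro card_mono) auto
    then have "\<not> proper_colouring {..<n} E f"
      using E(3)[of f] by auto
    then obtain u v where "u < n" "v < n" "E u v" "f u = f v"
      by (auto simp: proper_colouring_def)
    then show "\<exists>i<r. \<exists>u\<in>C i. \<exists>v\<in>C i. (u, v) \<in> parcs G"
      using f[of u] f[of v] by (auto simp: G_def)
  qed
  moreover have "clique_number G \<le> w"
    unfolding clique_number_def
  proof (rule Max.boundedI)
    let ?S = "{card K |K. K \<subseteq> pverts G \<and> (\<forall>u\<in>K. \<forall>v\<in>K. u \<noteq> v \<longrightarrow> (u, v) \<in> parcs G)}"
    show le: "c \<le> w" if "c \<in> ?S" for c
      using that E(4) by (auto simp: G_def is_clique_def)
    then show "finite ?S"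
      \<comment> \<open>The bound \<open>w\<close> itself shows that the set under
        \<open>Max\<close> is finite.\<close>
      by (meson finite_nat_set_iff_bounded_le)
    show "?S \<noteq> {}" by auto
  qed
  ultimately have "G \<in> H_v r q"
    using assms(2) by (simp add: H_v_def)
  then have "F_v r q \<le> enat (card (pverts G))"
    unfolding F_v_def by (rule INF_lower)
  then show ?thesis by (simp add: G_def)
qed

theorem theorem3p1:
  fixes r s :: nat
  assumes "r \<ge> 3 * s + 6"
  shows "F_v r (r - s - 1) \<le> enat (r + 2 * s + 7)"
proof -
  define m where "m = r - (3 * s + 6)"
  have r: "r = 3 * s + 6 + m"
    using assms by (simp add: m_def)
  \<comment> \<open>The sums and products stay unevaluated so that they match the conclusions of the
    join and copy lemmas.\<close>
  have "realizable (13 + (s * 5 + m * 1)) (7 + (s * 3 + m * 1)) (4 + (s * 2 + m * 1))"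
    by (intro realizable_join realizable_copies realizable_vertex realizable_5_cycle
        realizable_Ramsey_graph)
  moreover have "13 + (s * 5 + m * 1) = r + 2 * s + 7" "7 + (s * 3 + m * 1) = Suc r"
    by (simp_all add: r)
  ultimately have "realizable (r + 2 * s + 7) (Suc r) (4 + (s * 2 + m * 1))"
    by (simp only:)
  then show ?thesis
    \<comment> \<open>The clique bound is 4 + 2s + m = r - s - 2, one below r - s - 1.\<close>
    by (rule F_v_le_of_realizable) (simp add: r)
qed

end
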